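(* Let $H_1,H_2,H_3,H_4$ be finite-dimensional complex Hilbert spaces and let $\rho$ be a (mixed) quantum state on $H_1\otimes H_2\otimes H_3\otimes H_4$. Suppose there is a pure state decomposition $\rho=\sum_k p_k|\psi_k\rangle\langle\psi_k|$ (with $p_k\ge 0$, $\sum_k p_k=1$, $|\psi_k\rangle$ unit vectors) which attains the minimum defining the concurrence of $\rho$, i.e. $\mathcal{C}_4(\rho)=\sum_k p_k\,\mathcal{C}_4(|\psi_k\rangle)$, and such that for every $|\psi_k\rangle$ in this decomposition $$\sum_{i=1}^4\bigl(1-\mathrm{Tr}((\rho^{(k)}_i)^2)\bigr)=\sum_{i=2}^4\bigl(1-\mathrm{Tr}((\rho^{(k)}_{1i})^2)\bigr),$$ where $\rho^{(k)}_i$ and $\rho^{(k)}_{1i}$ denote the reduced density matrices of $|\psi_k\rangle\langle\psi_k|$ on subsystem $i$ and on subsystems $\{1,i\}$, respectively. Then $$\mathcal{C}_4^2(\rho)\geq\frac15\,\widetilde{\mathcal{C}}_3^2(\rho),$$ where $$\widetilde{\mathcal{C}}_3^2(\rho)=\mathcal{C}_3^2(\rho_{1|2|34})+\mathcal{C}_3^2(\rho_{1|3|24})+\mathcal{C}_3^2(\rho_{1|4|23})+\mathcal{C}_3^2(\rho_{12|3|4})+\mathcal{C}_3^2(\rho_{13|2|4})+\mathcal{C}_3^2(\rho_{14|2|3}).$$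
   Context: $M$-partite concurrence with respect to a partition: let $|\psi\rangle\in H_1\otimes\cdots\otimes H_N$ be a unit vector and let $\mathcal{P}$ be a partition of $\{1,\dots,N\}$ into $M$ non-empty blocks. Each block is regarded as a single party, and $$\mathcal{C}_M(|\psi\rangle_{\mathcal{P}})=2^{1-\frac M2}\sqrt{(2^M-2)-\sum_\alpha \mathrm{Tr}(\rho_\alpha^2)},$$ where $\alpha$ runs over all $2^M-2$ non-empty proper subsets of the set of blocks of $\mathcal{P}$, and $\rho_\alpha$ is the reduced density matrix of $|\psi\rangle\langle\psi|$ on the union of the blocks in $\alpha$ (partial trace over all other subsystems). For $M=N$ (all blocks singletons) this is the $N$-partite concurrence $\mathcal{C}_N(|\psi\rangle)$. For a mixed state $\rho$ the concurrence is given by the convex roof $$\mathcal{C}_M(\rho_{\mathcal{P}})=\min_{\{p_k,|\psi_k\rangle\}}\sum_k p_k\,\mathcal{C}_M(|\psi_k\rangle_{\mathcal{P}}),$$ the minimum being over all pure state decompositions $\rho=\sum_k p_k|\psi_k\rangle\langle\psi_k|$ with $p_k\ge0$, $\sum_kp_k=1$ and $|\psi_k\rangle$ unit vectors; for $M=N$ it is denoted $\mathcal{C}_N(\rho)$. A notation such as $\rho_{1|2|34}$ indicates the tripartite partition with blocks $\{1\},\{2\},\{3,4\}$ of the four-partite system. *)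

theory Defs
  imports Complex_Main "HOL-Library.FuncSet" "HOL-Library.Disjoint_Sets"
begin

text \<open>
  The parties are \<open>1, \<dots>, N\<close>; party \<open>i\<close> has the Hilbert space \<open>\<complex>^(d i)\<close> with standard basis
  labelled by \<open>{..<d i}\<close>.  For a set \<open>S\<close> of parties, the product basis of the tensor product of the
  spaces of \<open>S\<close> is labelled by \<open>labels d S\<close>.  A vector is the function of its coordinates and an
  operator is the function of its matrix entries; only their values on \<open>labels d S\<close> are meaningful.
\<close>

type_synonym ket = "(nat \<Rightarrow> nat) \<Rightarrow> complex"
type_synonym oper = "(nat \<Rightarrow> nat) \<Rightarrow> (nat \<Rightarrow> nat) \<Rightarrow> complex"

definition labels :: "(nat \<Rightarrow> nat) \<Rightarrow> nat set \<Rightarrow> (nat \<Rightarrow> nat) set" where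
  "labels d S = (\<Pi>\<^sub>E i\<in>S. {..<d i})"

definition unit_ket :: "(nat \<Rightarrow> nat) \<Rightarrow> nat set \<Rightarrow> ket \<Rightarrow> bool" where
  "unit_ket d S \<psi> \<longleftrightarrow> (\<Sum>x\<in>labels d S. (cmod (\<psi> x))\<^sup>2) = 1"

definition oper_trace :: "(nat \<Rightarrow> nat) \<Rightarrow> nat set \<Rightarrow> oper \<Rightarrow> complex" where
  "oper_trace d S A = (\<Sum>x\<in>labels d S. A x x)"

definition oper_mult :: "(nat \<Rightarrow> nat) \<Rightarrow> nat set \<Rightarrow> oper \<Rightarrow> oper \<Rightarrow> oper" where
  "oper_mult d S A B = (\<lambda>x y. \<Sum>z\<in>labels d S. A x z * B z y)"

definition density_oper :: "(nat \<Rightarrow> nat) \<Rightarrow> nat set \<Rightarrow> oper \<Rightarrow> bool" where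
  "density_oper d S \<rho> \<longleftrightarrow>
     (\<forall>x\<in>labels d S. \<forall>y\<in>labels d S. \<rho> y x = cnj (\<rho> x y)) \<and>
     (\<forall>v :: ket. 0 \<le> Re (\<Sum>x\<in>labels d S. \<Sum>y\<in>labels d S. cnj (v x) * \<rho> x y * v y)) \<and>
     oper_trace d S \<rho> = 1"

definition projector :: "ket \<Rightarrow> oper" where
  "projector \<psi> = (\<lambda>x y. \<psi> x * cnj (\<psi> y))"

text \<open>
  Partial trace of an operator on the parties \<open>1, \<dots>, N\<close> over the parties outside \<open>S\<close>.
  The label \<open>override_on z x S\<close> agrees with \<open>x\<close> on \<open>S\<close> and with \<open>z\<close> elsewhere.
\<close>
definition reduced :: "nat \<Rightarrow> (nat \<Rightarrow> nat) \<Rightarrow> nat set \<Rightarrow> oper \<Rightarrow> oper" where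
  "reduced N d S A =
     (\<lambda>x y. \<Sum>z\<in>labels d ({1..N} - S). A (override_on z x S) (override_on z y S))"

text \<open>\<open>Tr (\<rho>\<^sub>S\<^sup>2)\<close> for the reduced density matrix \<open>\<rho>\<^sub>S\<close> of a vector; this trace is real.\<close>
definition purity :: "nat \<Rightarrow> (nat \<Rightarrow> nat) \<Rightarrow> nat set \<Rightarrow> ket \<Rightarrow> real" where
  "purity N d S \<psi> =
     Re (oper_trace d S
       (oper_mult d S (reduced N d S (projector \<psi>)) (reduced N d S (projector \<psi>))))"

text \<open>In the following, \<open>P\<close> is meant to satisfy \<open>partition_on {1..N} P\<close>, and \<open>M = card P\<close>.\<close>
definition pure_concurrence :: "nat \<Rightarrow> (nat \<Rightarrow> nat) \<Rightarrow> nat set set \<Rightarrow> ket \<Rightarrow> real" where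
  "pure_concurrence N d P \<psi> =
     2 powr (1 - real (card P) / 2) *
     sqrt ((2 ^ card P - 2) - (\<Sum>\<alpha> | \<alpha> \<subset> P \<and> \<alpha> \<noteq> {}. purity N d (\<Union>\<alpha>) \<psi>))"

definition pure_decomposition ::
  "nat \<Rightarrow> (nat \<Rightarrow> nat) \<Rightarrow> oper \<Rightarrow> nat \<Rightarrow> (nat \<Rightarrow> real) \<Rightarrow> (nat \<Rightarrow> ket) \<Rightarrow> bool" where
  "pure_decomposition N d \<rho> n p \<psi> \<longleftrightarrow>
     (\<forall>k<n. 0 \<le> p k) \<and> (\<Sum>k<n. p k) = 1 \<and> (\<forall>k<n. unit_ket d {1..N} (\<psi> k)) \<and>
     (\<forall>x\<in>labels d {1..N}. \<forall>y\<in>labels d {1..N}.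
        \<rho> x y = (\<Sum>k<n. of_real (p k) * projector (\<psi> k) x y))"

definition decomposition_values :: "nat \<Rightarrow> (nat \<Rightarrow> nat) \<Rightarrow> nat set set \<Rightarrow> oper \<Rightarrow> real set" where
  "decomposition_values N d P \<rho> =
     {\<Sum>k<n. p k * pure_concurrence N d P (\<psi> k) | n p \<psi>. pure_decomposition N d \<rho> n p \<psi>}"

text \<open>
  The convex roof is a minimum over an infinite set, rendered as the infimum; the lemma below
  records the agreement with the minimum.
\<close>
definition concurrence :: "nat \<Rightarrow> (nat \<Rightarrow> nat) \<Rightarrow> nat set set \<Rightarrow> oper \<Rightarrow> real" where
  "concurrence N d P \<rho> = Inf (decomposition_values N d P \<rho>)"

lemma concurrence_eq_minimum:
  assumes "c \<in> decomposition_values N d P \<rho>"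
    and "\<And>c'. c' \<in> decomposition_values N d P \<rho> \<Longrightarrow> c \<le> c'"
  shows "concurrence N d P \<rho> = c"
  unfolding concurrence_def using assms by (rule cInf_eq_minimum)

definition singleton_blocks :: "nat \<Rightarrow> nat set set" where
  "singleton_blocks N = (\<lambda>i. {i}) ` {1..N}"

lemma partition_on_singleton_blocks: "partition_on {1..N} (singleton_blocks N)"
  by (auto simp: singleton_blocks_def partition_on_def disjoint_def)

end

theory Submission
  imports Defs "HOL-Analysis.L2_Norm"
begin

text \<open>
  For a pure state the purities of complementary sets of parties agree.  Hence, with \<open>A\<close> and \<open>B\<close>
  the two sides of the hypothesis, the squared four-partite concurrence is \<open>(A + B) / 2\<close>, while the
  six squared tripartite concurrences add up to \<open>3 A + 2 B\<close>; for \<open>A = B\<close> the ratio is exactly \<open>5\<close>.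
  Minkowski's inequality for the vectors of the six tripartite concurrences carries this over to
  the optimal decomposition, which bounds each tripartite convex roof from above.
\<close>

section \<open>Splitting labels between a set of parties and its complement\<close>

lemma labels_undefined: "x \<in> labels d S \<Longrightarrow> i \<notin> S \<Longrightarrow> x i = undefined"
  unfolding labels_def by (rule PiE_arb)

text \<open>Gluing a label of \<open>S\<close> to a label of its complement is a bijection onto the
  labels of all parties. Its inverse is the pair of restrictions, because labels are extensional and
  hence determined by their values on their own parties.\<close>

lemma sum_labels_split:
  assumes "S \<subseteq> {1..N}"
  shows "(\<Sum>x\<in>labels d S. \<Sum>z\<in>labels d ({1..N} - S). f (override_on z x S)) =
         (\<Sum>u\<in>labels d {1..N}. f u)"
proof -
  have "(\<Sum>x\<in>labels d S. \<Sum>z\<in>labels d ({1..N} - S). f (override_on z x S)) =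
        (\<Sum>(x, z)\<in>labels d S \<times> labels d ({1..N} - S). f (override_on z x S))"
    by (rule sum.cartesian_product)
  also have "\<dots> = (\<Sum>u\<in>labels d {1..N}. f u)"
  proof (rule sum.reindex_bij_witness[where i = "\<lambda>u. (restrict u S, restrict u ({1..N} - S))"
        and j = "\<lambda>(x, z). override_on z x S"])
    fix a assume a: "a \<in> labels d S \<times> labels d ({1..N} - S)"
    then obtain x z where xz: "a = (x, z)" "x \<in> labels d S" "z \<in> labels d ({1..N} - S)"
      by blast
    have "restrict (override_on z x S) S = x"
      using labels_undefined[OF xz(2)] by (auto simp: override_on_def)
    moreover have "restrict (override_on z x S) ({1..N} - S) = z"
      using labels_undefined[OF xz(3)] by (auto simp: override_on_def)
    ultimately show "(restrict (case a of (x, z) \<Rightarrow> override_on z x S) S,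
        restrict (case a of (x, z) \<Rightarrow> override_on z x S) ({1..N} - S)) = a"
      using xz(1) by simp
    have "override_on z x S i \<in> {..<d i}" if "i \<in> {1..N}" for i
      using xz(2,3) that by (cases "i \<in> S") (auto simp: labels_def PiE_iff)
    moreover have "override_on z x S i = undefined" if "i \<notin> {1..N}" for i
      using labels_undefined[OF xz(3)] that assms by (auto simp: override_on_def)
    ultimately show "(case a of (x, z) \<Rightarrow> override_on z x S) \<in> labels d {1..N}"
      using xz(1) by (auto simp: labels_def intro!: PiE_I)
    show "f (case a of (x, z) \<Rightarrow> override_on z x S) = (case a of (x, z) \<Rightarrow> f (override_on z x S))"
      using xz(1) by simp
  next
    fix u assume u: "u \<in> labels d {1..N}"
    show "(case (restrict u S, restrict u ({1..N} - S)) of (x, z) \<Rightarrow> override_on z x S) = u"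
      using labels_undefined[OF u] by (auto simp: override_on_def)
    show "(restrict u S, restrict u ({1..N} - S)) \<in> labels d S \<times> labels d ({1..N} - S)"
      using u assms by (auto simp: labels_def)
  qed
  finally show ?thesis .
qed

text \<open>The delicate points are those outside \<open>{1..N}\<close>: there one side takes its
  value from \<open>x\<close> and the other from \<open>z\<close>, and both are
  \<open>undefined\<close>.\<close>

lemma override_on_labels_swap:
  assumes "S \<subseteq> {1..N}" "x \<in> labels d S" "z \<in> labels d ({1..N} - S)"
  shows "override_on x z ({1..N} - S) = override_on z x S"
  using assms(1) labels_undefined[OF assms(2)] labels_undefined[OF assms(3)]
  by (auto simp: override_on_def fun_eq_iff)

section \<open>Purities of reduced states\<close>

lemma purity_expand:
  "purity N d S \<psi> = Re (\<Sum>x\<in>labels d S. \<Sum>y\<in>labels d S.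
     \<Sum>z\<in>labels d ({1..N} - S). \<Sum>w\<in>labels d ({1..N} - S).
       \<psi> (override_on z x S) * cnj (\<psi> (override_on z y S)) *
       (\<psi> (override_on w y S) * cnj (\<psi> (override_on w x S))))"
  by (simp add: purity_def oper_trace_def oper_mult_def reduced_def projector_def sum_product)

text \<open>No Schmidt decomposition is needed: exchanging the roles of \<open>x, y\<close> and
  \<open>z, w\<close> in the fourfold sum only makes the two conjugated factors trade
  places.\<close>

lemma purity_complement:
  assumes "S \<subseteq> {1..N}"
  shows "purity N d ({1..N} - S) \<psi> = purity N d S \<psi>"
proof -
  let ?L = "labels d S" and ?K = "labels d ({1..N} - S)"
  let ?g = "\<lambda>x y z w. \<psi> (override_on z x S) * cnj (\<psi> (override_on z y S)) *
    (\<psi> (override_on w y S) * cnj (\<psi> (override_on w x S)))"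
  have dbl: "{1..N} - ({1..N} - S) = S"
    using assms by auto
  have "purity N d ({1..N} - S) \<psi> = Re (\<Sum>z\<in>?K. \<Sum>w\<in>?K. \<Sum>x\<in>?L. \<Sum>y\<in>?L. ?g x y z w)"
    unfolding purity_expand dbl
    by (intro arg_cong[where f = Re] sum.cong refl)
       (simp add: override_on_labels_swap[OF assms] ac_simps del: One_nat_def)
  \<comment> \<open>With \<open>z\<close> and \<open>w\<close> bundled into one index, two exchanges
    of sums move them past \<open>x\<close> and \<open>y\<close>.\<close>
  also have "(\<Sum>z\<in>?K. \<Sum>w\<in>?K. \<Sum>x\<in>?L. \<Sum>y\<in>?L. ?g x y z w) =
      (\<Sum>(z, w)\<in>?K \<times> ?K. \<Sum>x\<in>?L. \<Sum>y\<in>?L. ?g x y z w)"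
    by (rule sum.cartesian_product)
  also have "\<dots> = (\<Sum>x\<in>?L. \<Sum>y\<in>?L. \<Sum>(z, w)\<in>?K \<times> ?K. ?g x y z w)"
    unfolding case_prod_unfold by (subst sum.swap) (intro sum.cong refl sum.swap)
  also have "\<dots> = (\<Sum>x\<in>?L. \<Sum>y\<in>?L. \<Sum>z\<in>?K. \<Sum>w\<in>?K. ?g x y z w)"
    by (intro sum.cong refl sum.cartesian_product[symmetric])
  finally show ?thesis
    by (simp only: purity_expand)
qed

text \<open>By Cauchy-Schwarz, the squared modulus of an entry of the reduced matrix is at most the
  product \<open>q x * q y\<close> of two diagonal entries. Summing over all entries gives the
  square of the trace, which is 1 by normalization.\<close>

lemma purity_le_1:
  assumes S: "S \<subseteq> {1..N}" and "unit_ket d {1..N} \<psi>"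
  shows "purity N d S \<psi> \<le> 1"
proof -
  let ?L = "labels d S" and ?K = "labels d ({1..N} - S)"
  let ?R = "reduced N d S (projector \<psi>)"
  define q where "q x = (\<Sum>z\<in>?K. (cmod (\<psi> (override_on z x S)))\<^sup>2)" for x
  have R: "Re (?R x y * ?R y x) \<le> q x * q y" for x y
  proof -
    have "?R y x = cnj (?R x y)"
      by (simp add: reduced_def projector_def mult.commute)
    then have "Re (?R x y * ?R y x) = (cmod (?R x y))\<^sup>2"
      by (simp add: complex_norm_square[symmetric])
    also have "\<dots> \<le> (\<Sum>z\<in>?K. cmod (\<psi> (override_on z x S)) * cmod (\<psi> (override_on z y S)))\<^sup>2"
      unfolding reduced_def projector_def
      by (intro power_mono order_trans[OF norm_sum]) (simp_all add: norm_mult)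
    also have "\<dots> \<le> (L2_set (\<lambda>z. cmod (\<psi> (override_on z x S))) ?K *
        L2_set (\<lambda>z. cmod (\<psi> (override_on z y S))) ?K)\<^sup>2"
      using L2_set_mult_ineq[of "\<lambda>z. cmod (\<psi> (override_on z x S))"
          "\<lambda>z. cmod (\<psi> (override_on z y S))" ?K]
      by (intro power_mono) (simp_all add: sum_nonneg)
    also have "\<dots> = q x * q y"
      by (simp add: q_def L2_set_def power_mult_distrib sum_nonneg)
    finally show ?thesis .
  qed
  have "purity N d S \<psi> = (\<Sum>x\<in>?L. \<Sum>y\<in>?L. Re (?R x y * ?R y x))"
    by (simp only: purity_def oper_trace_def oper_mult_def Re_sum)
  also have "\<dots> \<le> (\<Sum>x\<in>?L. \<Sum>y\<in>?L. q x * q y)"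
    by (intro sum_mono R)
  also have "\<dots> = (\<Sum>x\<in>?L. q x)\<^sup>2"
    by (simp add: power2_eq_square sum_product)
  also have "(\<Sum>x\<in>?L. q x) = 1"
    using sum_labels_split[OF S, where d = d and f = "\<lambda>u. (cmod (\<psi> u))\<^sup>2"] assms(2)
    by (simp add: q_def unit_ket_def)
  finally show ?thesis by simp
qed

section \<open>Sums over subsets of a partition and squared pure-state concurrences\<close>

lemma sum_Pow_insert:
  assumes "finite A" "a \<notin> A"
  shows "sum f (Pow (insert a A)) = sum f (Pow A) + (\<Sum>B\<in>Pow A. f (insert a B))"
proof -
  have "inj_on (insert a) (Pow A)"
    using assms(2) by (auto simp: inj_on_def)
  moreover have "Pow A \<inter> insert a ` Pow A = {}"
    using assms(2) by auto
  ultimately show ?thesis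
    using assms(1) by (simp add: Pow_insert sum.union_disjoint sum.reindex)
qed

lemma sum_proper_subsets:
  fixes f :: "'a set \<Rightarrow> real"
  assumes "finite P" "P \<noteq> {}"
  shows "(\<Sum>\<alpha> | \<alpha> \<subset> P \<and> \<alpha> \<noteq> {}. f \<alpha>) = sum f (Pow P) - f {} - f P"
proof -
  have "{\<alpha>. \<alpha> \<subset> P \<and> \<alpha> \<noteq> {}} = Pow P - {{}, P}"
    by auto
  then show ?thesis
    using assms by (simp add: sum_diff)
qed

text \<open>This makes the radicand in \<open>pure_concurrence\<close> nonnegative. Without it,
  \<open>sqrt\<close> could be negative and its square would not return the radicand.\<close>

lemma sum_purity_proper_subsets_le:
  assumes "finite P" "P \<noteq> {}" "\<Union>P \<subseteq> {1..N}" "unit_ket d {1..N} \<psi>"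
  shows "(\<Sum>\<alpha> | \<alpha> \<subset> P \<and> \<alpha> \<noteq> {}. purity N d (\<Union>\<alpha>) \<psi>) \<le> 2 ^ card P - 2"
proof -
  have "(\<Sum>\<alpha> | \<alpha> \<subset> P \<and> \<alpha> \<noteq> {}. purity N d (\<Union>\<alpha>) \<psi>) \<le> (\<Sum>\<alpha> | \<alpha> \<subset> P \<and> \<alpha> \<noteq> {}. 1)"
    using assms(3,4) by (intro sum_mono purity_le_1) auto
  also have "\<dots> = 2 ^ card P - 2"
    unfolding sum_proper_subsets[OF assms(1,2)] using assms(1) by (simp add: card_Pow)
  finally show ?thesis .
qed

lemma pure_concurrence_nonneg:
  assumes "finite P" "P \<noteq> {}" "\<Union>P \<subseteq> {1..N}" "unit_ket d {1..N} \<psi>"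
  shows "0 \<le> pure_concurrence N d P \<psi>"
  using sum_purity_proper_subsets_le[OF assms] by (simp add: pure_concurrence_def)

lemma pure_concurrence_square:
  assumes "finite P" "P \<noteq> {}" "\<Union>P \<subseteq> {1..N}" "unit_ket d {1..N} \<psi>"
  shows "(pure_concurrence N d P \<psi>)\<^sup>2 =
    2 powr (2 - real (card P)) *
      ((2 ^ card P - 2) - (\<Sum>\<alpha> | \<alpha> \<subset> P \<and> \<alpha> \<noteq> {}. purity N d (\<Union>\<alpha>) \<psi>))"
proof -
  have "(2 powr (1 - real (card P) / 2))\<^sup>2 = (2 powr (2 - real (card P)) :: real)"
    by (simp add: power2_eq_square powr_add[symmetric])
  then show ?thesis
    using sum_purity_proper_subsets_le[OF assms]
    by (simp add: pure_concurrence_def power_mult_distrib)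
qed

text \<open>The six proper subsets are the three blocks and their complements, so each purity occurs
  twice; the prefactor 1/2 cancels this.\<close>

lemma pure_concurrence_square_tripartite:
  assumes P: "partition_on {1..N} {A, B, C}" and distinct: "A \<noteq> B" "A \<noteq> C" "B \<noteq> C"
    and "unit_ket d {1..N} \<psi>"
  shows "(pure_concurrence N d {A, B, C} \<psi>)\<^sup>2 =
    (1 - purity N d A \<psi>) + (1 - purity N d B \<psi>) + (1 - purity N d C \<psi>)"
proof -
  have un: "A \<union> (B \<union> C) = {1..N}"
    using partition_onD1[OF P] by auto
  have disj: "A \<inter> B = {}" "A \<inter> C = {}" "B \<inter> C = {}"
    using partition_onD2[OF P] distinct by (auto simp: disjoint_def)
  have "B \<union> C = {1..N} - A" "A \<union> C = {1..N} - B" "A \<union> B = {1..N} - C"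
    using un disj by blast+
  moreover have "A \<subseteq> {1..N}" "B \<subseteq> {1..N}" "C \<subseteq> {1..N}"
    using un by blast+
  ultimately have compl: "purity N d (B \<union> C) \<psi> = purity N d A \<psi>"
      "purity N d (A \<union> C) \<psi> = purity N d B \<psi>" "purity N d (A \<union> B) \<psi> = purity N d C \<psi>"
    using purity_complement by metis+
  show ?thesis
    using distinct partition_onD1[OF P] assms(5)
    by (simp add: pure_concurrence_square sum_proper_subsets sum_Pow_insert compl
        powr_minus field_simps)
qed

text \<open>These equations choose representatives: all purities reduce to those of the singletons
  and of the pairs containing party 1.\<close>

lemma purity_complement_4:
  "purity 4 d {2, 3, 4} \<psi> = purity 4 d {1} \<psi>"
  "purity 4 d {1, 3, 4} \<psi> = purity 4 d {2} \<psi>"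
  "purity 4 d {1, 2, 4} \<psi> = purity 4 d {3} \<psi>"
  "purity 4 d {1, 2, 3} \<psi> = purity 4 d {4} \<psi>"
  "purity 4 d {3, 4} \<psi> = purity 4 d {1, 2} \<psi>"
  "purity 4 d {2, 4} \<psi> = purity 4 d {1, 3} \<psi>"
  "purity 4 d {2, 3} \<psi> = purity 4 d {1, 4} \<psi>"
proof -
  have compl: "purity 4 d T \<psi> = purity 4 d S \<psi>" if "S \<subseteq> {1..4}" "{1..4} - S = T" for S T
    using purity_complement[OF that(1), of d \<psi>] that(2) by simp
  show "purity 4 d {2, 3, 4} \<psi> = purity 4 d {1} \<psi>"
    "purity 4 d {1, 3, 4} \<psi> = purity 4 d {2} \<psi>"
    "purity 4 d {1, 2, 4} \<psi> = purity 4 d {3} \<psi>"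
    "purity 4 d {1, 2, 3} \<psi> = purity 4 d {4} \<psi>"
    "purity 4 d {3, 4} \<psi> = purity 4 d {1, 2} \<psi>"
    "purity 4 d {2, 4} \<psi> = purity 4 d {1, 3} \<psi>"
    "purity 4 d {2, 3} \<psi> = purity 4 d {1, 4} \<psi>"
    by (rule compl; force)+
qed

text \<open>The 14 proper subsets form four singleton-triple pairs and three pair-pair splittings.
  Each purity thus counts twice, and the prefactor 1/4 leaves 1/2.\<close>

lemma pure_concurrence_square_singleton_blocks_4:
  assumes "unit_ket d {1..4} \<psi>"
  shows "(pure_concurrence 4 d (singleton_blocks 4) \<psi>)\<^sup>2 =
    ((\<Sum>i=1..4. 1 - purity 4 d {i} \<psi>) + (\<Sum>i=2..4. 1 - purity 4 d {1, i} \<psi>)) / 2"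
proof -
  have iv: "{1..4::nat} = {1, 2, 3, 4}" "{2..4::nat} = {2, 3, 4}"
    by auto
  then have blocks: "singleton_blocks 4 = {{1}, {2}, {3}, {4}}"
    by (simp add: singleton_blocks_def)
  have "(pure_concurrence 4 d {{1}, {2}, {3}, {4}} \<psi>)\<^sup>2 =
      1 / 4 * (14 - (\<Sum>\<alpha> | \<alpha> \<subset> {{1}, {2}, {3}, {4}} \<and> \<alpha> \<noteq> {}. purity 4 d (\<Union>\<alpha>) \<psi>))"
    using assms by (subst pure_concurrence_square) (auto simp: powr_minus)
  then show ?thesis
    unfolding blocks iv using purity_complement_4[of d \<psi>]
    by (simp add: sum_proper_subsets sum_Pow_insert insert_commute field_simps)
qed

section \<open>Bounds on the convex roof\<close>

lemma decomposition_values_nonneg: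
  assumes "finite P" "P \<noteq> {}" "\<Union>P \<subseteq> {1..N}" "c \<in> decomposition_values N d P \<rho>"
  shows "0 \<le> c"
  using assms(4) pure_concurrence_nonneg[OF assms(1-3)]
  by (auto simp: decomposition_values_def pure_decomposition_def intro!: sum_nonneg)

text \<open>The given decomposition serves only to make the set of values nonempty, since
  \<open>Inf\<close> of the empty set of reals gives no information.\<close>

lemma concurrence_nonneg:
  assumes "finite P" "P \<noteq> {}" "\<Union>P \<subseteq> {1..N}" "pure_decomposition N d \<rho> n p \<psi>"
  shows "0 \<le> concurrence N d P \<rho>"
  unfolding concurrence_def
proof (rule cInf_greatest)
  show "decomposition_values N d P \<rho> \<noteq> {}"
    using assms(4) by (auto simp: decomposition_values_def)
qed (rule decomposition_values_nonneg[OF assms(1-3)])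

lemma concurrence_le:
  assumes "finite P" "P \<noteq> {}" "\<Union>P \<subseteq> {1..N}" "pure_decomposition N d \<rho> n p \<psi>"
  shows "concurrence N d P \<rho> \<le> (\<Sum>k<n. p k * pure_concurrence N d P (\<psi> k))"
  unfolding concurrence_def
proof (rule cInf_lower)
  show "(\<Sum>k<n. p k * pure_concurrence N d P (\<psi> k)) \<in> decomposition_values N d P \<rho>"
    using assms(4) by (auto simp: decomposition_values_def)
  show "bdd_below (decomposition_values N d P \<rho>)"
    using decomposition_values_nonneg[OF assms(1-3)] by (rule bdd_belowI)
qed

section \<open>Minkowski's inequality and the comparison of concurrences\<close>

lemma L2_set_sum_le:
  "L2_set (\<lambda>i. \<Sum>k\<in>K. f k i) A \<le> (\<Sum>k\<in>K. L2_set (f k) A)"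
proof (induction K rule: infinite_finite_induct)
  case (insert k K)
  then show ?case
    using L2_set_triangle_ineq[of "f k" "\<lambda>i. \<Sum>k\<in>K. f k i" A] by simp
\<comment> \<open>For infinite \<open>K\<close> both sums over \<open>K\<close> are 0 by convention,
  as in the empty case.\<close>
qed (simp_all add: L2_set_def)

theorem theorem4:
  fixes d :: "nat \<Rightarrow> nat" and \<rho> :: oper
    and n :: nat and p :: "nat \<Rightarrow> real" and \<psi> :: "nat \<Rightarrow> ket"
  assumes "density_oper d {1..4} \<rho>"
    and "pure_decomposition 4 d \<rho> n p \<psi>"
    and "concurrence 4 d (singleton_blocks 4) \<rho> =
           (\<Sum>k<n. p k * pure_concurrence 4 d (singleton_blocks 4) (\<psi> k))"
    and "\<forall>k<n. (\<Sum>i=1..4. 1 - purity 4 d {i} (\<psi> k)) =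
                (\<Sum>i=2..4. 1 - purity 4 d {1, i} (\<psi> k))"
  shows "(concurrence 4 d (singleton_blocks 4) \<rho>)\<^sup>2 \<ge>
    1 / 5 *
      ((concurrence 4 d {{1}, {2}, {3, 4}} \<rho>)\<^sup>2 +
       (concurrence 4 d {{1}, {3}, {2, 4}} \<rho>)\<^sup>2 +
       (concurrence 4 d {{1}, {4}, {2, 3}} \<rho>)\<^sup>2 +
       (concurrence 4 d {{1, 2}, {3}, {4}} \<rho>)\<^sup>2 +
       (concurrence 4 d {{1, 3}, {2}, {4}} \<rho>)\<^sup>2 +
       (concurrence 4 d {{1, 4}, {2}, {3}} \<rho>)\<^sup>2)"
proof -
  \<comment> \<open>Listing the six partitions turns their concurrences into a vector indexed by
    \<open>i < 6\<close>, to which \<open>L2_set\<close> applies.\<close>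
  define Ps :: "nat set set list" where
    "Ps = [{{1}, {2}, {3, 4}}, {{1}, {3}, {2, 4}}, {{1}, {4}, {2, 3}},
           {{1, 2}, {3}, {4}}, {{1, 3}, {2}, {4}}, {{1, 4}, {2}, {3}}]"
  have iv: "{1..4::nat} = {1, 2, 3, 4}" "{2..4::nat} = {2, 3, 4}" "{..<6::nat} = {0, 1, 2, 3, 4, 5}"
    by auto
  have Ps: "finite (Ps ! i)" "Ps ! i \<noteq> {}" "\<Union>(Ps ! i) \<subseteq> {1..4}" if "i < 6" for i
  proof -
    have "\<forall>P\<in>set Ps. finite P \<and> P \<noteq> {} \<and> \<Union>P \<subseteq> {1..4}"
      by (simp add: Ps_def)
    moreover have "Ps ! i \<in> set Ps"
      by (rule nth_mem) (use that in \<open>simp add: Ps_def\<close>)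
    ultimately show "finite (Ps ! i)" "Ps ! i \<noteq> {}" "\<Union>(Ps ! i) \<subseteq> {1..4}"
      by blast+
  qed
  have unit: "unit_ket d {1..4} (\<psi> k)" and p: "0 \<le> p k" if "k < n" for k
    using assms(2) that by (auto simp: pure_decomposition_def)
  have pure: "L2_set (\<lambda>i. pure_concurrence 4 d (Ps ! i) (\<psi> k)) {..<6} =
      sqrt 5 * pure_concurrence 4 d (singleton_blocks 4) (\<psi> k)" if "k < n" for k
  proof -
    note tri = pure_concurrence_square_tripartite[OF _ _ _ _ unit[OF that]]
    \<comment> \<open>Each party is a block of its own in three of the six partitions, whence the 3.
      Each splitting of the parties into two pairs occurs twice, once with either pair as the merged
      block, whence the 2.\<close>
    have "(\<Sum>i<6. (pure_concurrence 4 d (Ps ! i) (\<psi> k))\<^sup>2) =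
        3 * (\<Sum>i=1..4. 1 - purity 4 d {i} (\<psi> k)) + 2 * (\<Sum>i=2..4. 1 - purity 4 d {1, i} (\<psi> k))"
    proof -
      have "(pure_concurrence 4 d {{1}, {2}, {3, 4}} (\<psi> k))\<^sup>2 =
          (1 - purity 4 d {1} (\<psi> k)) + (1 - purity 4 d {2} (\<psi> k)) + (1 - purity 4 d {3, 4} (\<psi> k))"
        "(pure_concurrence 4 d {{1}, {3}, {2, 4}} (\<psi> k))\<^sup>2 =
          (1 - purity 4 d {1} (\<psi> k)) + (1 - purity 4 d {3} (\<psi> k)) + (1 - purity 4 d {2, 4} (\<psi> k))"
        "(pure_concurrence 4 d {{1}, {4}, {2, 3}} (\<psi> k))\<^sup>2 =
          (1 - purity 4 d {1} (\<psi> k)) + (1 - purity 4 d {4} (\<psi> k)) + (1 - purity 4 d {2, 3} (\<psi> k))"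
        "(pure_concurrence 4 d {{1, 2}, {3}, {4}} (\<psi> k))\<^sup>2 =
          (1 - purity 4 d {1, 2} (\<psi> k)) + (1 - purity 4 d {3} (\<psi> k)) + (1 - purity 4 d {4} (\<psi> k))"
        "(pure_concurrence 4 d {{1, 3}, {2}, {4}} (\<psi> k))\<^sup>2 =
          (1 - purity 4 d {1, 3} (\<psi> k)) + (1 - purity 4 d {2} (\<psi> k)) + (1 - purity 4 d {4} (\<psi> k))"
        "(pure_concurrence 4 d {{1, 4}, {2}, {3}} (\<psi> k))\<^sup>2 =
          (1 - purity 4 d {1, 4} (\<psi> k)) + (1 - purity 4 d {2} (\<psi> k)) + (1 - purity 4 d {3} (\<psi> k))"
        by (rule tri; force simp: partition_on_def disjoint_def)+
      then show ?thesis
        unfolding purity_complement_4 iv by (simp add: Ps_def)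
    qed
    \<comment> \<open>The hypothesis on the purities enters here: both sums equal the squared
      four-partite concurrence.\<close>
    also have "\<dots> = 5 * (pure_concurrence 4 d (singleton_blocks 4) (\<psi> k))\<^sup>2"
      using assms(4) that
      by (simp add: pure_concurrence_square_singleton_blocks_4[OF unit[OF that]])
    finally show ?thesis
      using pure_concurrence_nonneg[OF _ _ _ unit[OF that], of "singleton_blocks 4"]
      by (simp add: L2_set_def real_sqrt_mult singleton_blocks_def)
  qed
  \<comment> \<open>The decomposition optimal for four parties need not be optimal for any
    tripartition, but it bounds every convex roof from above. Nonnegativity of the roofs makes the
    norm monotone.\<close>
  have "L2_set (\<lambda>i. concurrence 4 d (Ps ! i) \<rho>) {..<6} \<le>
      L2_set (\<lambda>i. \<Sum>k<n. p k * pure_concurrence 4 d (Ps ! i) (\<psi> k)) {..<6}"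
    using concurrence_le[OF Ps assms(2)] concurrence_nonneg[OF Ps assms(2)]
    by (intro L2_set_mono) auto
  also have "\<dots> \<le> (\<Sum>k<n. L2_set (\<lambda>i. p k * pure_concurrence 4 d (Ps ! i) (\<psi> k)) {..<6})"
    by (rule L2_set_sum_le)
  also have "\<dots> = (\<Sum>k<n. p k * L2_set (\<lambda>i. pure_concurrence 4 d (Ps ! i) (\<psi> k)) {..<6})"
    by (intro sum.cong refl) (simp add: L2_set_right_distrib p)
  \<comment> \<open>Attainment of the minimum turns the average over the decomposition back into the
    four-partite convex roof.\<close>
  also have "\<dots> = sqrt 5 * concurrence 4 d (singleton_blocks 4) \<rho>"
    by (simp add: assms(3) pure sum_distrib_left ac_simps)
  finally have "(L2_set (\<lambda>i. concurrence 4 d (Ps ! i) \<rho>) {..<6})\<^sup>2 \<le>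
      (sqrt 5 * concurrence 4 d (singleton_blocks 4) \<rho>)\<^sup>2"
    by (intro power_mono) simp_all
  then have "(\<Sum>i<6. (concurrence 4 d (Ps ! i) \<rho>)\<^sup>2) \<le>
      5 * (concurrence 4 d (singleton_blocks 4) \<rho>)\<^sup>2"
    by (simp add: L2_set_def sum_nonneg power_mult_distrib)
  then show ?thesis
    by (simp add: iv Ps_def)
qed

end
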